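(* Let $q$ be an odd prime power and let $f(x) = (x+1/x)^2/4$. The map $\mathcal{O}_v \mapsto f(v)$ gives a (well-defined) bijection between the set of orbits $\mathcal{O}_v$ with $v\in\mu_{2(q-1)}\cup \mu_{2(q+1)}$ and the set of elements of $\mathbb{F}_q$. The inverse map is $\tau \mapsto \mathcal{O}_v$, where $v = \sqrt{\tau}+\sqrt{\tau-1}\in\overline{\mathbb{F}}_q$ (for any choice of the square roots), and this orbit consists of the elements $\pm\sqrt{\tau}\pm\sqrt{\tau-1}$ (all sign combinations). The two orbits $\{1,-1\}$ and $\{i,-i\}$ (where $i^2=-1$) correspond to $\tau = 1$ and $\tau=0$, respectively. Moreover, suppose $\tau\in\mathbb{F}_q$ and $\mathcal{O}_v$ correspond to each other under this bijection. Then $\tau \notin\{0,1\}$ if and only if $v^4 \ne 1$, and in that case, for all $A,B \in \{1,-1\}$, $$\left(\frac{\tau}{q}\right)=A \ \text{ and }\ \left(\frac{\tau-1}{q}\right)=B \iff v^{q-AB}=A.$$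
   Context: $q$ is an odd prime power, $\mathbb{F}_q$ is the field with $q$ elements, and $\overline{\mathbb{F}}_q$ is its algebraic closure. For $k>0$ relatively prime to $q$, $\mu_k$ denotes the group of $k$th roots of unity in $\overline{\mathbb{F}}_q$. For $0\ne v\in\overline{\mathbb{F}}_q$, the orbit of $v$ is the set $\mathcal{O}_v=\{v,1/v,-v,-1/v\}$. For $a\in\mathbb{F}_q$, the Legendre symbol $\left(\frac{a}{q}\right)\in\mathbb{Z}$ equals $1$, $-1$ or $0$ according as $a$ is a nonzero square in $\mathbb{F}_q$, a nonsquare in $\mathbb{F}_q$, or $0$. In the equation $v^{q-AB}=A$, the right-hand side $A=\pm1$ is regarded as an element of $\mathbb{F}_q$. *)

theory Defs
  imports
    "HOL-Library.Cardinality"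
    "HOL-Algebra.Algebraic_Closure_Type"
    "HOL-Number_Theory.Prime_Powers"
begin

text \<open>
  The field \<open>F\<^sub>q\<close> is a type \<open>'a :: finite_field\<close> with \<open>CARD('a) = q\<close>; its algebraic
  closure is \<open>'a alg_closure\<close>, with embedding \<open>to_ac\<close>.
\<close>

definition mu :: "nat \<Rightarrow> 'a::field alg_closure set" where
  "mu k = {v. v ^ k = 1}"

definition param_set :: "nat \<Rightarrow> 'a::field alg_closure set" where
  "param_set q = mu (2 * (q - 1)) \<union> mu (2 * (q + 1))"

text \<open>Only meant for \<open>v \<noteq> 0\<close>.\<close>
definition orb :: "'a::field alg_closure \<Rightarrow> 'a alg_closure set" where
  "orb v = {v, 1 / v, - v, - (1 / v)}"

definition f :: "'a::field alg_closure \<Rightarrow> 'a alg_closure" where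
  "f x = (x + 1 / x)\<^sup>2 / 4"

text \<open>
  The quadratic character of a finite field. The library's \<open>Legendre\<close> only covers residues of
  integers modulo a prime.
\<close>
definition field_Legendre :: "'a::finite_field \<Rightarrow> int" where
  "field_Legendre a = (if a = 0 then 0 else if \<exists>y. a = y\<^sup>2 then 1 else - 1)"

end

theory Submission
  imports Defs "HOL-Number_Theory.Residues"
begin

text \<open>
  Write \<open>F\<close> for the field with \<open>q\<close> elements. Two ideas carry the proof.

  The first is that \<open>f\<close> is the quotient map for the group generated by \<open>v \<mapsto> 1 / v\<close> and \<open>v \<mapsto> - v\<close>:
  on nonzero elements its fibres are exactly the orbits (\<open>f_eq_iff\<close>). Since the Frobenius map
  \<open>x \<mapsto> x ^ q\<close> is a field endomorphism whose fixed points are the elements of \<open>F\<close>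
  (\<open>range_to_ac_iff\<close>), and \<open>f\<close> has coefficients in \<open>F\<close>, for \<open>v \<noteq> 0\<close> the value \<open>f v\<close> lies in \<open>F\<close> iff
  \<open>f (v ^ q) = f v\<close>, that is, \<open>v ^ q\<close> is one of \<open>v, - v, 1 / v, - (1 / v)\<close>. The first two
  possibilities say \<open>v ^ (2 * (q - 1)) = 1\<close> and the last two say \<open>v ^ (2 * (q + 1)) = 1\<close>. So
  \<open>param_set q\<close> is the set of nonzero \<open>v\<close> with \<open>f v\<close> in \<open>F\<close> (\<open>f_in_range_iff\<close>), and \<open>f\<close> induces an injection
  from the orbits inside \<open>param_set q\<close> to \<open>F\<close>.

  The second is the change of variables \<open>r = (v + 1 / v) / 2\<close>, \<open>s = (v - 1 / v) / 2\<close>. It satisfies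
  \<open>r\<^sup>2 = f v\<close>, \<open>s\<^sup>2 = f v - 1\<close>, \<open>v = r + s\<close> and \<open>1 / v = r - s\<close>; conversely any
  square roots \<open>r\<close> of \<open>\<tau>\<close> and \<open>s\<close> of \<open>\<tau> - 1\<close> satisfy \<open>(r + s) * (r - s) = 1\<close> and thus give
  \<open>f (r + s) = \<tau>\<close> (\<open>orb_sqrt_sum\<close>). This proves surjectivity and describes the inverse. It also
  yields the criterion for the quadratic characters: a nonzero \<open>\<tau>\<close> has character \<open>A\<close> exactly if
  Frobenius multiplies its square root \<open>r\<close> by \<open>A\<close> (\<open>field_Legendre_eq_iff\<close>). If Frobenius
  multiplies \<open>r\<close> by \<open>A\<close> and \<open>s\<close> by \<open>B\<close>, then it maps \<open>v = r + s\<close> to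
  \<open>A * r + B * s = A * (r + A * B * s)\<close>, which is \<open>A\<close> times \<open>v\<close> or \<open>1 / v\<close> according to the sign
  of \<open>A * B\<close>; and this argument can be reversed (\<open>frobenius_sqrt_pair_iff\<close>).
\<close>

section \<open>Fibres of f and square roots\<close>

lemma orb_eq_iff:
  fixes v w :: "'a::field alg_closure"
  assumes "v \<noteq> 0"
  shows "orb w = orb v \<longleftrightarrow> w \<in> orb v"
proof
  show "orb w = orb v" if "w \<in> orb v"
    using that assms by (auto simp: orb_def)
qed (auto simp: orb_def)

lemma four_neq_zero: "(2 :: 'a::field) \<noteq> 0 \<Longrightarrow> (4 :: 'a) \<noteq> 0"
  using no_zero_divisors[of "2 :: 'a" 2] by simp

text \<open>
  After taking square roots, \<open>f w = f v\<close> means \<open>w + 1 / w = \<plusminus> (v + 1 / v)\<close>, and the difference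
  of the two sides factors as \<open>(w - v) * (w - 1 / v) / w\<close>, respectively with all signs of \<open>v\<close>
  changed.
\<close>
lemma f_eq_iff:
  fixes v w :: "'a::field alg_closure"
  assumes two: "(2 :: 'a alg_closure) \<noteq> 0" and v: "v \<noteq> 0" and w: "w \<noteq> 0"
  shows "f w = f v \<longleftrightarrow> w \<in> orb v"
proof -
  have "(4 :: 'a alg_closure) \<noteq> 0"
    by (rule four_neq_zero[OF two])
  hence "f w = f v \<longleftrightarrow> (w + 1 / w)\<^sup>2 = (v + 1 / v)\<^sup>2"
    by (simp add: f_def)
  also have "\<dots> \<longleftrightarrow> w + 1 / w = v + 1 / v \<or> w + 1 / w = - (v + 1 / v)"
    by (rule power2_eq_iff)
  also have "w + 1 / w = v + 1 / v \<longleftrightarrow> w = v \<or> w = 1 / v"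
  proof -
    have "w + 1 / w - (v + 1 / v) = (w - v) * (w - 1 / v) / w"
      using v w by (simp add: diff_divide_distrib add_divide_distrib algebra_simps)
    thus ?thesis
      using w by (metis divide_eq_0_iff eq_iff_diff_eq_0 mult_eq_0_iff)
  qed
  also have "w + 1 / w = - (v + 1 / v) \<longleftrightarrow> w = - v \<or> w = - (1 / v)"
  proof -
    have "w + 1 / w + (v + 1 / v) = (w + v) * (w + 1 / v) / w"
      using v w by (simp add: diff_divide_distrib add_divide_distrib algebra_simps)
    thus ?thesis
      using w by (metis divide_eq_0_iff eq_neg_iff_add_eq_0 mult_eq_0_iff)
  qed
  finally show ?thesis
    by (auto simp: orb_def)
qed

text \<open>This is what makes a function on orbits out of \<open>f\<close> without choosing representatives.\<close>
lemma f_image_orb: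
  assumes "(2 :: 'a::field alg_closure) \<noteq> 0" and "v \<noteq> 0"
  shows "f ` orb v = {f (v :: 'a alg_closure)}"
proof -
  have "0 \<notin> orb v" "v \<in> orb v"
    using assms(2) by (auto simp: orb_def)
  thus ?thesis
    using f_eq_iff[OF assms] by (intro equalityI image_subsetI) (auto, metis)
qed

text \<open>
  Everything follows from \<open>(r + s) * (r - s) = r\<^sup>2 - s\<^sup>2 = 1\<close>, so that \<open>1 / (r + s) = r - s\<close>.
\<close>
lemma orb_sqrt_sum:
  fixes r s t :: "'a::field alg_closure"
  assumes two: "(2 :: 'a alg_closure) \<noteq> 0" and r: "r\<^sup>2 = t" and s: "s\<^sup>2 = t - 1"
  shows "r + s \<noteq> 0" and "f (r + s) = t"
    and "orb (r + s) = {r + s, r - s, - r + s, - r - s}"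
proof -
  have prod: "(r + s) * (r - s) = 1"
    using r s by (simp add: algebra_simps power2_eq_square)
  thus nz: "r + s \<noteq> 0" by auto
  have inv: "1 / (r + s) = r - s"
    using prod nz by (simp add: field_simps)
  have "(4 :: 'a alg_closure) \<noteq> 0"
    by (rule four_neq_zero[OF two])
  moreover have "r + s + (r - s) = 2 * r" by simp
  ultimately show "f (r + s) = t"
    unfolding f_def inv using r by (simp add: power_mult_distrib)
  show "orb (r + s) = {r + s, r - s, - r + s, - r - s}"
    unfolding orb_def inv by auto
qed

text \<open>The inverse of the parametrisation \<open>v = r + s\<close>, \<open>1 / v = r - s\<close> used above.\<close>
lemma f_as_square:
  fixes v :: "'a::field alg_closure"
  assumes two: "(2 :: 'a alg_closure) \<noteq> 0" and v: "v \<noteq> 0"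
  shows "((v + 1 / v) / 2)\<^sup>2 = f v" and "((v - 1 / v) / 2)\<^sup>2 = f v - 1"
proof -
  have four: "(4 :: 'a alg_closure) \<noteq> 0"
    by (rule four_neq_zero[OF two])
  show "((v + 1 / v) / 2)\<^sup>2 = f v"
    by (simp add: f_def power_divide)
  have four_eq: "(2 :: 'a alg_closure)\<^sup>2 = 4" by simp
  have "(v - 1 / v)\<^sup>2 = (v + 1 / v)\<^sup>2 - 4"
    using v by (simp add: power2_sum power2_diff)
  thus "((v - 1 / v) / 2)\<^sup>2 = f v - 1"
    using four by (simp only: f_def power_divide diff_divide_distrib[of _ 4 4] four_eq) simp
qed

text \<open>
  By the previous lemma \<open>f v = 0\<close> means \<open>v + 1 / v = 0\<close>, i.e. \<open>v\<^sup>2 = - 1\<close>, and \<open>f v = 1\<close> means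
  \<open>v - 1 / v = 0\<close>, i.e. \<open>v\<^sup>2 = 1\<close>.
\<close>
lemma f_eq_0_or_1_iff:
  fixes v :: "'a::field alg_closure"
  assumes two: "(2 :: 'a alg_closure) \<noteq> 0" and v: "v \<noteq> 0"
  shows "f v \<in> {0, 1} \<longleftrightarrow> v ^ 4 = 1"
proof -
  have "f v = 0 \<longleftrightarrow> v + 1 / v = 0"
    unfolding f_as_square(1)[OF assms, symmetric] using two by simp
  also have "v + 1 / v = (v\<^sup>2 + 1) / v"
    using v by (simp add: add_divide_distrib power2_eq_square)
  also have "(v\<^sup>2 + 1) / v = 0 \<longleftrightarrow> v\<^sup>2 = -1"
    using v by (simp add: eq_neg_iff_add_eq_0)
  finally have 0: "f v = 0 \<longleftrightarrow> v\<^sup>2 = -1" .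
  have "f v = 1 \<longleftrightarrow> f v - 1 = 0"
    by simp
  also have "\<dots> \<longleftrightarrow> v - 1 / v = 0"
    unfolding f_as_square(2)[OF assms, symmetric] using two by simp
  also have "v - 1 / v = (v\<^sup>2 - 1) / v"
    using v by (simp add: diff_divide_distrib power2_eq_square)
  also have "(v\<^sup>2 - 1) / v = 0 \<longleftrightarrow> v\<^sup>2 = 1"
    using v by simp
  finally have 1: "f v = 1 \<longleftrightarrow> v\<^sup>2 = 1" .
  have "v ^ 4 = 1 \<longleftrightarrow> (v\<^sup>2)\<^sup>2 = 1"
    by (simp flip: power_mult)
  also have "\<dots> \<longleftrightarrow> v\<^sup>2 = 1 \<or> v\<^sup>2 = -1"
    by (rule power2_eq_1_iff)
  finally show ?thesis
    using 0 1 by blast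
qed

section \<open>The Frobenius map on the algebraic closure\<close>

lemma two_neq_zero:
  assumes "odd CARD('a::finite_field)"
  shows "(2 :: 'a alg_closure) \<noteq> 0"
proof
  assume "(2 :: 'a alg_closure) = 0"
  hence "of_nat 2 = (0 :: 'a)"
    by (metis to_ac_eq_0_iff to_ac_numeral of_nat_numeral)
  hence "CHAR('a) dvd 2"
    by (simp only: of_nat_eq_0_iff_char_dvd)
  hence "CHAR('a) = 2"
    using CHAR_not_1'[where 'a = 'a] CHAR_prime[where 'a = 'a] primes_dvd_imp_eq two_is_prime_nat by blast
  thus False
    using CHAR_dvd_CARD[where 'a = 'a] assms by simp
qed

lemma frobenius_add:
  fixes x y :: "'a::finite_field alg_closure"
  assumes "primepow CARD('a)"
  shows "(x + y) ^ CARD('a) = x ^ CARD('a) + y ^ CARD('a)"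
proof -
  obtain p k where p: "prime p" "CARD('a) = p ^ k"
    using assms by (auto simp: primepow_def)
  have "CHAR('a) dvd p ^ k"
    using CHAR_dvd_CARD[where 'a = 'a] p by simp
  hence "CHAR('a) = p"
    using p(1) CHAR_prime[where 'a = 'a] prime_dvd_power primes_dvd_imp_eq by blast
  thus ?thesis
    using p by (intro freshmans_dream'[where n = k]) auto
qed

text \<open>
  The \<open>q\<close> elements of \<open>F\<close> are roots of \<open>X ^ q - X\<close>, and this polynomial has at most \<open>q\<close> roots.
\<close>
lemma range_to_ac_iff:
  "x \<in> range (to_ac :: 'a::finite_field \<Rightarrow> _) \<longleftrightarrow> x ^ CARD('a) = x"
proof -
  define q where "q = CARD('a)"
  define P :: "'a alg_closure poly" where "P = Polynomial.monom 1 q - Polynomial.monom 1 1"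
  have "card {0, 1 :: 'a} \<le> q"
    unfolding q_def by (rule card_mono) auto
  hence q: "q > 1" by simp
  have root_iff: "poly P y = 0 \<longleftrightarrow> y ^ q = y" for y
    by (simp add: P_def poly_monom)
  have "coeff P q = 1"
    using q by (simp add: P_def)
  hence P: "P \<noteq> 0" by auto
  have deg: "Polynomial.degree P \<le> q"
    unfolding P_def using q by (intro degree_diff_le) (auto simp: degree_monom_eq)
  have sub: "range to_ac \<subseteq> {y. poly P y = 0}"
    unfolding root_iff q_def using finite_field_power_card_eq_same[where 'a = 'a]
    by (auto simp flip: to_ac_power)
  have "card (range (to_ac :: 'a \<Rightarrow> _)) = q"
    by (simp add: card_image inj_to_ac q_def)
  hence "card {y. poly P y = 0} \<le> card (range (to_ac :: 'a \<Rightarrow> _))"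
    using card_poly_roots_bound[OF P] deg by linarith
  hence "range to_ac = {y. poly P y = 0}"
    using poly_roots_finite[OF P] sub by (intro card_seteq)
  thus ?thesis
    by (simp add: root_iff q_def)
qed

section \<open>The parameter set is the preimage of the finite field\<close>

lemma param_set_nonzero:
  "v \<in> param_set q \<Longrightarrow> q > 1 \<Longrightarrow> v \<noteq> 0"
  by (auto simp: param_set_def mu_def power_0_left)

lemma orb_1: "orb (1 :: 'a::field alg_closure) = {1, - 1}"
  by (auto simp: orb_def)

lemma one_in_param_set: "(1 :: 'a::field alg_closure) \<in> param_set q"
  by (simp add: param_set_def mu_def)

text \<open>
  The two defining equations read \<open>(v ^ q)\<^sup>2 = v\<^sup>2\<close> and \<open>(v ^ q * v)\<^sup>2 = 1\<close>; taking square roots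
  gives two of the four elements of the orbit each.
\<close>
lemma param_set_iff_power_in_orb:
  fixes v :: "'a::field alg_closure"
  assumes "v \<noteq> 0" "q > 0"
  shows "v \<in> param_set q \<longleftrightarrow> v ^ q \<in> orb v"
proof -
  have "v ^ (2 * (q - 1)) = 1 \<longleftrightarrow> v ^ (2 * (q - 1)) * v ^ 2 = v ^ 2"
    using assms by simp
  also have "v ^ (2 * (q - 1)) * v ^ 2 = (v ^ q)\<^sup>2"
  proof -
    have "2 * (q - 1) + 2 = q * 2"
      using assms(2) by simp
    thus ?thesis
      by (metis power_add power_mult)
  qed
  also have "(v ^ q)\<^sup>2 = v\<^sup>2 \<longleftrightarrow> v ^ q = v \<or> v ^ q = - v"
    by (rule power2_eq_iff)
  finally have minus: "v \<in> mu (2 * (q - 1)) \<longleftrightarrow> v ^ q = v \<or> v ^ q = - v"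
    by (simp add: mu_def)
  have "v ^ (2 * (q + 1)) = (v ^ q * v)\<^sup>2"
    by (metis Suc_eq_plus1 mult.commute power_Suc power_mult)
  hence "v ^ (2 * (q + 1)) = 1 \<longleftrightarrow> v ^ q * v = 1 \<or> v ^ q * v = -1"
    by (simp only: power2_eq_1_iff)
  also have "\<dots> \<longleftrightarrow> v ^ q = 1 / v \<or> v ^ q = - (1 / v)"
    using assms(1) by (simp add: eq_divide_eq flip: divide_minus_left)
  finally have "v \<in> mu (2 * (q + 1)) \<longleftrightarrow> v ^ q = 1 / v \<or> v ^ q = - (1 / v)"
    by (simp add: mu_def)
  with minus show ?thesis
    by (auto simp: param_set_def orb_def)
qed

lemma f_power_card:
  fixes v :: "'a::finite_field alg_closure"
  assumes "primepow CARD('a)"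
  shows "f v ^ CARD('a) = f (v ^ CARD('a))"
proof -
  have "(4 :: 'a alg_closure) \<in> range to_ac"
    by (metis rangeI to_ac_numeral)
  hence "(4 :: 'a alg_closure) ^ CARD('a) = 4"
    by (simp only: range_to_ac_iff)
  thus ?thesis
    by (simp add: f_def power_divide frobenius_add[OF assms] flip: power_mult)
       (simp add: mult.commute power_mult frobenius_add[OF assms] power_divide)
qed

lemma f_in_range_iff:
  fixes v :: "'a::finite_field alg_closure"
  assumes "primepow CARD('a)" "odd CARD('a)" "v \<noteq> 0"
  shows "f v \<in> range to_ac \<longleftrightarrow> v \<in> param_set CARD('a)"
proof -
  have "f v \<in> range to_ac \<longleftrightarrow> f (v ^ CARD('a)) = f v"
    by (simp add: range_to_ac_iff f_power_card[OF assms(1)])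
  also have "\<dots> \<longleftrightarrow> v ^ CARD('a) \<in> orb v"
    using assms by (intro f_eq_iff two_neq_zero) auto
  also have "\<dots> \<longleftrightarrow> v \<in> param_set CARD('a)"
    using assms by (intro param_set_iff_power_in_orb[symmetric]) auto
  finally show ?thesis .
qed

section \<open>Quadratic characters via Frobenius\<close>

text \<open>
  Frobenius fixes \<open>a\<close>, hence maps its square root \<open>r\<close> to \<open>r\<close> or \<open>- r\<close>. It fixes \<open>r\<close> exactly if
  \<open>r\<close> lies in the finite field, which means that \<open>a\<close> is a square there.
\<close>
lemma field_Legendre_eq_iff:
  fixes a :: "'a::finite_field"
  assumes odd: "odd CARD('a)" and r: "r\<^sup>2 = to_ac a" and a: "a \<noteq> 0" and A: "A \<in> {1, -1}"
  shows "field_Legendre a = A \<longleftrightarrow> r ^ CARD('a) = of_int A * r"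
proof -
  have r0: "r \<noteq> 0"
    using r a by auto
  have neq: "r \<noteq> - r"
    using r0 two_neq_zero[OF odd] by (metis add_eq_0_iff mult_2 mult_eq_0_iff)
  have "(r ^ CARD('a))\<^sup>2 = (r\<^sup>2) ^ CARD('a)"
    by (simp only: power_mult[symmetric] mult.commute)
  also have "\<dots> = r\<^sup>2"
    unfolding r range_to_ac_iff[symmetric] by simp
  finally have "(r ^ CARD('a))\<^sup>2 = r\<^sup>2" .
  hence pm: "r ^ CARD('a) = r \<or> r ^ CARD('a) = - r"
    by (simp add: power2_eq_iff)
  have "(\<exists>y. a = y\<^sup>2) \<longleftrightarrow> r \<in> range to_ac"
  proof
    assume "\<exists>y. a = y\<^sup>2"
    then obtain y where "a = y\<^sup>2" ..
    hence "r\<^sup>2 = (to_ac y)\<^sup>2" using r by simp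
    hence "r = to_ac y \<or> r = to_ac (- y)" by (simp add: power2_eq_iff)
    thus "r \<in> range to_ac" by blast
  next
    assume "r \<in> range to_ac"
    then obtain y where "r = to_ac y" ..
    hence "to_ac a = to_ac (y\<^sup>2)" using r by simp
    hence "a = y\<^sup>2" by (simp only: to_ac_eq_iff)
    thus "\<exists>y. a = y\<^sup>2" ..
  qed
  hence "field_Legendre a = (if r ^ CARD('a) = r then 1 else -1)"
    using a by (simp add: field_Legendre_def range_to_ac_iff)
  thus ?thesis
    using A pm neq by auto
qed

text \<open>
  A condition on the pair \<open>(r, s)\<close> is equivalent to one on the pair \<open>(r + s, r - s) = (v, 1 / v)\<close>,
  because 2 is invertible; and there the condition on \<open>1 / v\<close> follows from the one on \<open>v\<close>.
\<close>
lemma frobenius_sqrt_pair_iff: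
  fixes v :: "'a::finite_field alg_closure"
  assumes pp: "primepow CARD('a)" and odd: "odd CARD('a)" and v: "v \<noteq> 0"
    and A: "A \<in> {1, -1::int}" and B: "B \<in> {1, -1}"
  defines "r \<equiv> (v + 1 / v) / 2" and "s \<equiv> (v - 1 / v) / 2"
  shows "r ^ CARD('a) = of_int A * r \<and> s ^ CARD('a) = of_int B * s \<longleftrightarrow>
    v powi (int CARD('a) - A * B) = of_int A"
proof -
  note two = two_neq_zero[OF odd]
  define w where "w = v ^ CARD('a)"
  have "(2 :: 'a alg_closure) \<in> range to_ac"
    by (metis rangeI to_ac_numeral)
  hence two_q: "(2 :: 'a alg_closure) ^ CARD('a) = 2"
    by (simp only: range_to_ac_iff)
  have diff: "(x - y) ^ CARD('a) = x ^ CARD('a) - y ^ CARD('a)" for x y :: "'a alg_closure"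
    using frobenius_add[OF pp, of x "- y"] odd by simp
  have rq: "r ^ CARD('a) = (w + 1 / w) / 2" and sq: "s ^ CARD('a) = (w - 1 / w) / 2"
    by (simp_all add: r_def s_def w_def power_divide two_q diff frobenius_add[OF pp])
  have sum: "x = y \<and> x' = y' \<longleftrightarrow> x + x' = y + y' \<and> x - x' = y - y'" for x y x' y' :: "'a alg_closure"
  proof
    assume h: "x + x' = y + y' \<and> x - x' = y - y'"
    have "(x + x') + (x - x') = (y + y') + (y - y')"
      by (simp only: h)
    hence "2 * x = 2 * y" by simp
    thus "x = y \<and> x' = y'" using two h by simp
  qed auto
  have halves: "(x + y) / 2 + (x - y) / 2 = x" "(x + y) / 2 - (x - y) / 2 = y" for x y :: "'a alg_closure"
    using two by (simp_all add: field_simps)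
  \<comment> \<open>\<open>u\<close> is \<open>v\<close> to the power \<open>A * B\<close>, so the claim becomes \<open>w = A * u\<close>.\<close>
  define u where "u = (if A * B = 1 then v else 1 / v)"
  have rs: "r + s = v" "r - s = 1 / v"
    unfolding r_def s_def by (rule halves)+
  have AB: "of_int A * r + of_int B * s = of_int A * u" "of_int A * r - of_int B * s = of_int A * (1 / u)"
    using A B v rs by (auto simp: u_def algebra_simps)
  have "r ^ CARD('a) = of_int A * r \<and> s ^ CARD('a) = of_int B * s \<longleftrightarrow>
      w = of_int A * u \<and> 1 / w = of_int A * (1 / u)"
    by (subst sum) (simp only: rq sq halves AB)
  also have "\<dots> \<longleftrightarrow> w = of_int A * u"
    using A by auto
  also have "\<dots> \<longleftrightarrow> w / u = of_int A"
    using v by (auto simp: u_def field_simps)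
  also have "w / u = v powi (int CARD('a) - A * B)"
    using A B v by (auto simp: u_def w_def power_int_diff power_int_add field_simps)
  finally show ?thesis .
qed

theorem theorem1p7:
  fixes q :: nat
  assumes "primepow q" and "odd q" and "CARD('a::finite_field) = q"
  shows "\<exists>\<Phi> :: 'a alg_closure set \<Rightarrow> 'a.
    (\<forall>v\<in>param_set q. to_ac (\<Phi> (orb v)) = f v) \<and>
    bij_betw \<Phi> (orb ` param_set q) UNIV \<and>
    (\<forall>\<tau> r s. r\<^sup>2 = to_ac \<tau> \<and> s\<^sup>2 = to_ac (\<tau> - 1) \<longrightarrow>
       inv_into (orb ` param_set q) \<Phi> \<tau> = orb (r + s) \<and>
       orb (r + s) = {r + s, r - s, - r + s, - r - s}) \<and>
    {1, - 1} \<in> orb ` param_set q \<and> \<Phi> {1, - 1} = 1 \<and>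
    (\<forall>i. i\<^sup>2 = - 1 \<longrightarrow> {i, - i} \<in> orb ` param_set q \<and> \<Phi> {i, - i} = 0) \<and>
    (\<forall>\<tau>. \<forall>v\<in>param_set q. \<Phi> (orb v) = \<tau> \<longrightarrow>
       (\<tau> \<notin> {0, 1} \<longleftrightarrow> v ^ 4 \<noteq> 1) \<and>
       (v ^ 4 \<noteq> 1 \<longrightarrow>
         (\<forall>A\<in>{1, - 1}. \<forall>B\<in>{1, - 1}.
            field_Legendre \<tau> = A \<and> field_Legendre (\<tau> - 1) = B \<longleftrightarrow>
            v powi (int q - A * B) = to_ac (of_int A))))"
proof -
  note card = assms(3)
  have pp: "primepow CARD('a)" and odd: "odd CARD('a)"
    using assms by auto
  have q1: "q > 1"
    using assms(1) primepow_gt_Suc_0[of q] by simp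
  note two = two_neq_zero[OF odd]
  have nz: "v \<noteq> 0" if "v \<in> param_set q" for v :: "'a alg_closure"
    using param_set_nonzero[OF that q1] .
  have param_iff: "v \<in> param_set q \<longleftrightarrow> f v \<in> range to_ac" if "v \<noteq> 0" for v :: "'a alg_closure"
    using f_in_range_iff[OF pp odd that] card by simp
  \<comment> \<open>\<open>f\<close> takes a single value on each orbit, and membership of the orbit in
    \<open>orb ` param_set q\<close> guarantees that \<open>of_ac\<close> is applied to an element of \<open>F\<close>.\<close>
  define \<Phi> :: "'a alg_closure set \<Rightarrow> 'a" where "\<Phi> = (\<lambda>Q. of_ac (the_elem (f ` Q)))"
  have \<Phi>: "to_ac (\<Phi> (orb v)) = f v" if "v \<in> param_set q" for v
    using that nz[OF that] by (simp add: \<Phi>_def f_image_orb[OF two] param_iff to_ac_of_ac)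
  have inj: "inj_on \<Phi> (orb ` param_set q)"
  proof (intro inj_onI, clarify)
    fix v w :: "'a alg_closure"
    assume vw: "v \<in> param_set q" "w \<in> param_set q" "\<Phi> (orb v) = \<Phi> (orb w)"
    hence "f v = f w"
      using \<Phi> by metis
    thus "orb v = orb w"
      using f_eq_iff[OF two nz nz] orb_eq_iff[OF nz] vw by metis
  qed
  have sqrt_sum: "r + s \<in> param_set q \<and> \<Phi> (orb (r + s)) = \<tau>"
    if "r\<^sup>2 = to_ac \<tau>" "s\<^sup>2 = to_ac (\<tau> - 1)" for \<tau> r s
  proof -
    have s: "s\<^sup>2 = to_ac \<tau> - 1" using that by simp
    have *: "f (r + s) = to_ac \<tau>" and "r + s \<noteq> 0"
      using orb_sqrt_sum[OF two that(1) s] by auto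
    hence p: "r + s \<in> param_set q" by (simp add: param_iff)
    from \<Phi>[OF this] * have "to_ac (\<Phi> (orb (r + s))) = to_ac \<tau>" by simp
    with p show ?thesis by (simp only: to_ac_eq_iff)
  qed
  have surj: "\<tau> \<in> \<Phi> ` orb ` param_set q" for \<tau>
  proof -
    obtain r s :: "'a alg_closure" where "r\<^sup>2 = to_ac \<tau>" "s\<^sup>2 = to_ac (\<tau> - 1)"
      using nth_root_exists[of 2] by (metis pos2)
    from sqrt_sum[OF this] show ?thesis by blast
  qed
  have bij: "bij_betw \<Phi> (orb ` param_set q) UNIV"
    using inj surj by (auto simp: bij_betw_def)
  have inverse: "inv_into (orb ` param_set q) \<Phi> \<tau> = orb (r + s) \<and>
       orb (r + s) = {r + s, r - s, - r + s, - r - s}"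
    if "r\<^sup>2 = to_ac \<tau>" "s\<^sup>2 = to_ac (\<tau> - 1)" for \<tau> r s
  proof
    have s: "s\<^sup>2 = to_ac \<tau> - 1" using that by simp
    show "inv_into (orb ` param_set q) \<Phi> \<tau> = orb (r + s)"
      using sqrt_sum[OF that] inj by (intro inv_into_f_eq) auto
    show "orb (r + s) = {r + s, r - s, - r + s, - r - s}"
      by (rule orb_sqrt_sum(3)[OF two that(1) s])
  qed
  \<comment> \<open>In the theorem the type of this occurrence of \<open>{1, - 1}\<close> is not tied to \<open>'a\<close>; hence the
    membership is shown over the closure of an arbitrary field.\<close>
  have one_mem: "{1, - 1} \<in> orb ` param_set q"
    using imageI[OF one_in_param_set, of orb] by (simp only: orb_1)
  have one: "\<Phi> {1, - 1} = 1"
    using sqrt_sum[of 1 1 0] by (simp add: orb_1)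
  have zero: "{i, - i} \<in> orb ` param_set q \<and> \<Phi> {i, - i} = 0" if "i\<^sup>2 = - 1" for i
  proof -
    have s: "i\<^sup>2 = 0 - 1" using that by simp
    have orb: "orb i = {i, - i}"
      using orb_sqrt_sum(3)[OF two _ s, of 0] by auto
    have "i \<in> param_set q \<and> \<Phi> (orb i) = 0"
      using sqrt_sum[of 0 0 i] that by simp
    with orb show ?thesis
      using imageI[of i "param_set q" orb] by simp
  qed
  have legendre: "(\<tau> \<notin> {0, 1} \<longleftrightarrow> v ^ 4 \<noteq> 1) \<and>
       (v ^ 4 \<noteq> 1 \<longrightarrow>
         (\<forall>A\<in>{1, - 1}. \<forall>B\<in>{1, - 1}.
            field_Legendre \<tau> = A \<and> field_Legendre (\<tau> - 1) = B \<longleftrightarrow>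
            v powi (int q - A * B) = to_ac (of_int A)))"
    if v: "v \<in> param_set q" and \<tau>: "\<Phi> (orb v) = \<tau>" for v \<tau>
  proof -
    have fv: "f v = to_ac \<tau>"
      using \<Phi>[OF v] \<tau> by simp
    have 4: "\<tau> \<notin> {0, 1} \<longleftrightarrow> v ^ 4 \<noteq> 1"
      using f_eq_0_or_1_iff[OF two nz[OF v]] by (simp add: fv)
    moreover have "field_Legendre \<tau> = A \<and> field_Legendre (\<tau> - 1) = B \<longleftrightarrow>
            v powi (int q - A * B) = to_ac (of_int A)"
      if "v ^ 4 \<noteq> 1" and A: "A \<in> {1, -1}" and B: "B \<in> {1, -1}" for A B
    proof -
      have \<tau>: "\<tau> \<noteq> 0" "\<tau> - 1 \<noteq> 0"
        using 4 that(1) by auto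
      note sq = f_as_square[OF two nz[OF v], unfolded fv]
      have sq2: "((v - 1 / v) / 2)\<^sup>2 = to_ac (\<tau> - 1)"
        using sq(2) by simp
      show ?thesis
        unfolding field_Legendre_eq_iff[OF odd sq(1) \<tau>(1) A] field_Legendre_eq_iff[OF odd sq2 \<tau>(2) B]
          frobenius_sqrt_pair_iff[OF pp odd nz[OF v] A B]
        by (simp add: card)
    qed
    ultimately show ?thesis by blast
  qed
  show ?thesis
    by (intro exI[of _ \<Phi>] conjI bij one_mem one;
        intro allI ballI impI; (elim conjE)?; rule \<Phi> inverse zero legendre; assumption)
qed

end
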